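(* Let $D\subset\mathbb{R}^2$ be a bounded simply connected domain with $C^1$ boundary and barycenter at the origin, which is either convex or, more generally, belongs to the class $\Sigma_{\arccos\frac{1}{\sqrt5}}$ (defined in the context). Assume that $\chi_D$ is a V-state with angular velocity $\Omega<0$, i.e. there is a constant $\mu\in\mathbb{R}$ with $$\psi(x)-\tfrac12\Omega|x|^2=\mu\quad\text{for all }x\in\partial D,\qquad \psi(x)=\frac1{2\pi}\int_D\log|x-y|\,dy .$$ Then $D$ is a disc.
   Context: A V-state (rotating patch) for the 2D incompressible Euler equations is a domain $D$ such that the vortex patch $\omega_0=\chi_D$ evolves as $\omega(t)=\chi_{D_t}$ with $D_t$ the rotation of $D$ about its barycenter (taken to be $0$) by angle $\Omega t$; for a $C^1$ boundary this is equivalent to the boundary equation displayed in the claim, where $\psi$ is the stream function of $\chi_D$. For $x_0\in\partial D$ let $\vec\nu(x_0)$ be the outward unit normal. For $\alpha\in[0,\pi/2]$ set $\mathrm{Sec}_{x_0,\alpha}=\{x\in\mathbb{R}^2\setminus\{x_0\}:\ \cos\alpha\le \frac{x-x_0}{|x-x_0|}\cdot\vec\nu(x_0)\}$, $D^+_{x_0}=\{x\in D:(x-x_0)\cdot\vec\nu(x_0)\ge0\}$, and $D^-_{x_0}=\{x-2[(x-x_0)\cdot\vec\nu(x_0)]\vec\nu(x_0): x\in D^+_{x_0}\}$ (reflection of $D^+_{x_0}$ across the tangent line at $x_0$). A $C^1$ bounded simply connected domain $D$ with barycenter $0$ belongs to the class $\Sigma_\alpha$ if for every $x_0\in\partial D$: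 (1) $x_0\cdot\vec\nu(x_0)\ge0$; (2) $\mathrm{Sec}_{x_0,\alpha}\cap D=\varnothing$; (3) $D^-_{x_0}\subset D$. *)

theory Defs
  imports "HOL-Analysis.Analysis"
begin

type_synonym pt = "real ^ 2"

definition outward_normal :: "pt set \<Rightarrow> pt \<Rightarrow> pt \<Rightarrow> bool" where
  "outward_normal D x0 nu \<longleftrightarrow>
     (\<exists>U g G. open U \<and> x0 \<in> U \<and> continuous_on U G \<and>
        (\<forall>x\<in>U. (g has_derivative (\<lambda>h. G x \<bullet> h)) (at x)) \<and>
        (\<forall>x\<in>U. G x \<noteq> 0) \<and>
        D \<inter> U = {x\<in>U. g x < 0} \<and>
        nu = G x0 /\<^sub>R norm (G x0))"

definition C1_boundary :: "pt set \<Rightarrow> bool" where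
  "C1_boundary D \<longleftrightarrow> (\<forall>x0\<in>frontier D. \<exists>nu. outward_normal D x0 nu)"

definition barycenter_zero :: "pt set \<Rightarrow> bool" where
  "barycenter_zero D \<longleftrightarrow> (\<lambda>x. x) integrable_on D \<and> integral D (\<lambda>x. x) = 0"

definition Sec :: "pt \<Rightarrow> pt \<Rightarrow> real \<Rightarrow> pt set" where
  "Sec x0 nu \<alpha> = {x. x \<noteq> x0 \<and> cos \<alpha> \<le> ((x - x0) /\<^sub>R norm (x - x0)) \<bullet> nu}"

definition Dplus :: "pt set \<Rightarrow> pt \<Rightarrow> pt \<Rightarrow> pt set" where
  "Dplus D x0 nu = {x\<in>D. (x - x0) \<bullet> nu \<ge> 0}"

definition Dminus :: "pt set \<Rightarrow> pt \<Rightarrow> pt \<Rightarrow> pt set" where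
  "Dminus D x0 nu = (\<lambda>x. x - (2 * ((x - x0) \<bullet> nu)) *\<^sub>R nu) ` Dplus D x0 nu"

definition Sigma_class :: "real \<Rightarrow> pt set \<Rightarrow> bool" where
  "Sigma_class \<alpha> D \<longleftrightarrow>
     bounded D \<and> open D \<and> connected D \<and> D \<noteq> {} \<and> simply_connected D \<and>
     C1_boundary D \<and> barycenter_zero D \<and>
     (\<forall>x0\<in>frontier D. \<forall>nu. outward_normal D x0 nu \<longrightarrow>
        x0 \<bullet> nu \<ge> 0 \<and> Sec x0 nu \<alpha> \<inter> D = {} \<and> Dminus D x0 nu \<subseteq> D)"

definition stream_fn :: "pt set \<Rightarrow> pt \<Rightarrow> real" where
  "stream_fn D x = (1 / (2 * pi)) * integral D (\<lambda>y. ln (norm (x - y)))"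

end

theory Submission
  imports Defs
begin

text \<open>
  Moving planes. Fix a unit vector \<open>e\<close> and let \<open>R\<close> be the reflection in the line \<open>x \<bullet> e = l\<close>, \<open>l > 0\<close>.
  If \<open>R\<close> maps the cap \<open>D \<inter> {x \<bullet> e > l}\<close> into \<open>D\<close>, then \<open>\<psi> (R x) \<le> \<psi> x\<close> on the cap side, and since
  \<open>|x|\<^sup>2 - |R x|\<^sup>2 = 4 l (x \<bullet> e - l)\<close> and \<open>\<Omega> < 0\<close>, the relative stream function
  \<open>\<phi> x = \<psi> x - \<Omega>/2 |x|\<^sup>2\<close> satisfies \<open>\<phi> x - \<phi> (R x) \<ge> 2|\<Omega>| l (x \<bullet> e - l)\<close>. Move the line in from infinity
  and suppose that the cap property is lost at some critical \<open>l > 0\<close>. Then either a reflected boundary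
  point off the line is again a boundary point, or \<open>e\<close> is tangent to the boundary at a point of the
  line. Both contradict the constancy of \<open>\<phi>\<close> on the boundary, the second one because \<open>\<psi>\<close> is Lipschitz.
  So the cap property holds for every \<open>l > 0\<close> and every \<open>e\<close>; applied to perpendicular bisectors it says
  that \<open>x \<in> D\<close> and \<open>|y| < |x|\<close> imply \<open>y \<in> D\<close>, i.e. \<open>D\<close> is a disc centred at the origin.
\<close>

section \<open>Reflections in lines: algebra, norms and invariance of Lebesgue measure\<close>

definition reflection :: "'a::real_inner \<Rightarrow> real \<Rightarrow> 'a \<Rightarrow> 'a" where
  "reflection e l x = x - (2 * (x \<bullet> e - l)) *\<^sub>R e"

lemma inner_reflection:
  assumes "norm e = 1"
  shows "reflection e l x \<bullet> e = 2 * l - x \<bullet> e"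
proof -
  have "e \<bullet> e = 1" using assms by (simp add: norm_eq_1)
  then show ?thesis by (simp add: reflection_def inner_diff_left)
qed

lemma reflection_involution:
  assumes "norm e = 1"
  shows "reflection e l (reflection e l x) = x"
  unfolding reflection_def[of e l "reflection e l x"] inner_reflection[OF assms]
  by (simp add: reflection_def algebra_simps flip: scaleR_add_left)

text \<open>The sign of the product tells whether \<open>x\<close> or its mirror image is nearer to
  \<open>y\<close>. This drives the comparison of logarithmic kernels; \<open>y = 0\<close> gives
  the change of \<open>|x|^2\<close>.\<close>

lemma norm_diff_reflection:
  assumes "norm e = 1"
  shows "(norm (reflection e l x - y))\<^sup>2 = (norm (x - y))\<^sup>2 + 4 * (x \<bullet> e - l) * (y \<bullet> e - l)"
proof -
  have e: "e \<bullet> e = 1" using assms by (simp add: norm_eq_1)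
  show ?thesis
    unfolding power2_norm_eq_inner reflection_def
    by (simp add: e inner_diff_left inner_diff_right inner_commute algebra_simps)
qed

lemma norm_reflection_diff_commute:
  assumes "norm e = 1"
  shows "norm (reflection e l x - y) = norm (x - reflection e l y)"
proof -
  have "(norm (reflection e l x - y))\<^sup>2 = (norm (x - reflection e l y))\<^sup>2"
    unfolding norm_minus_commute[of x] norm_diff_reflection[OF assms]
    by (simp add: norm_minus_commute algebra_simps)
  then show ?thesis by (simp add: power2_eq_iff_nonneg)
qed

lemma norm_reflection:
  assumes "norm e = 1"
  shows "(norm (reflection e l x))\<^sup>2 = (norm x)\<^sup>2 - 4 * l * (x \<bullet> e - l)"
  using norm_diff_reflection[OF assms, of l x 0] by (simp add: algebra_simps)

lemma continuous_on_reflection: "continuous_on S (reflection e l)"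
  unfolding reflection_def by (intro continuous_intros)

lemma orthogonal_transformation_reflection:
  assumes "norm e = 1"
  shows "orthogonal_transformation (reflection e 0)"
  unfolding orthogonal_transformation
proof
  show "linear (reflection e 0)"
    by (rule linearI) (simp_all add: reflection_def algebra_simps)
  show "\<forall>v. norm (reflection e 0 v) = norm v"
    using norm_reflection[OF assms, of 0] by (simp add: power2_eq_iff_nonneg)
qed

text \<open>It suffices to test boxes: the preimage of a box is a translate of its image under the
  linear isometry \<open>reflection e 0\<close>, and both maps preserve measure.\<close>

lemma lborel_distr_reflection:
  fixes e :: "real ^ 'n::{finite,wellorder}"
  assumes "norm e = 1"
  shows "distr lborel borel (reflection e l) = lborel"
proof (rule lborel_eqI[symmetric])
  fix a b :: "real ^ 'n::{finite,wellorder}" assume ab: "\<And>i. i \<in> Basis \<Longrightarrow> a \<bullet> i \<le> b \<bullet> i"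
  have [measurable]: "reflection e l \<in> borel_measurable borel"
    by (intro borel_measurable_continuous_onI continuous_on_reflection)
  have img: "reflection e l -` box a b = (+) ((2 * l) *\<^sub>R e) ` (reflection e 0 ` box a b)"
  proof -
    have eq: "reflection e l x = (2 * l) *\<^sub>R e + reflection e 0 x" for x
      by (simp add: reflection_def algebra_simps)
    have "reflection e l -` box a b = reflection e l ` box a b"
    proof (intro set_eqI iffI)
      fix x assume "x \<in> reflection e l -` box a b"
      then show "x \<in> reflection e l ` box a b"
        using reflection_involution[OF assms, of l x] by (metis image_eqI vimageE)
    qed (auto simp: reflection_involution[OF assms])
    then show ?thesis unfolding image_image eq[symmetric] .
  qed
  have box: "box a b \<in> lmeasurable" by simp
  note orth = orthogonal_transformation_reflection[OF assms]
  have m: "reflection e 0 ` box a b \<in> lmeasurable"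
    by (rule measurable_orthogonal_image[OF orth box])
  have m2: "reflection e l -` box a b \<in> lmeasurable"
    unfolding img by (rule measurable_translation[OF m])
  have "measure lebesgue (reflection e l -` box a b) = measure lebesgue (box a b)"
    unfolding img measure_translation by (rule measure_orthogonal_image[OF orth box])
  then have "emeasure lebesgue (reflection e l -` box a b) = emeasure lebesgue (box a b)"
    using m2 box by (simp only: emeasure_eq_measure2)
  moreover have "reflection e l -` box a b \<in> sets borel"
    using measurable_sets[of "reflection e l" borel borel "box a b"] by simp
  ultimately have "emeasure lborel (reflection e l -` box a b) = emeasure lborel (box a b)"
    by simp
  then show "emeasure (distr lborel borel (reflection e l)) (box a b) = (\<Prod>i\<in>Basis. (b - a) \<bullet> i)"
    using ab by (simp add: emeasure_distr emeasure_lborel_box)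
qed simp

section \<open>Integrability of \<open>1 / |x - y|\<close> and \<open>ln |x - y|\<close> in the
  plane\<close>

text \<open>What matters is that the bound does not depend on \<open>x\<close>: the discs around
  \<open>x\<close> contribute the sum of \<open>2^(k+1) * pi * 4^(-k)\<close>, which is
  \<open>4 * pi\<close>, and the points at distance at least 1 cost no more than the area of
  \<open>S\<close>.\<close>

lemma nn_integral_inverse_norm_le:
  fixes x :: "real ^ 2"
  assumes "S \<in> sets borel"
  shows "(\<integral>\<^sup>+ y. ennreal (indicator S y * (1 / norm (x - y))) \<partial>lborel)
           \<le> ennreal (4 * pi) + emeasure lborel S"
proof -
  have [measurable]: "S \<in> sets borel" by fact
  \<comment> \<open>On the dyadic annulus \<open>2 ^ -(k+1) < |x - y| \<le> 2 ^ -k\<close> the integrand is below \<open>2 ^ (k+1)\<close>.\<close>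
  let ?g = "\<lambda>k y. ennreal (2 ^ Suc k) * indicator (cball x ((1/2) ^ k)) y"
  have g: "?g k \<in> borel_measurable lborel" for k
    by (intro borel_measurable_times_ennreal borel_measurable_const borel_measurable_indicator) simp
  have pw: "ennreal (indicator S y * (1 / norm (x - y))) \<le> (\<Sum>k. ?g k y) + indicator S y" for y
  \<comment> \<open>The point \<open>y = x\<close> belongs to the easy case because
    \<open>1 / 0 = 0\<close>.\<close>
  proof (cases "y = x \<or> norm (x - y) \<ge> 1 \<or> y \<notin> S")
    case True
    then have "indicator S y * (1 / norm (x - y)) \<le> (indicator S y :: real)"
      by (auto simp: indicator_def divide_le_eq)
    then have "ennreal (indicator S y * (1 / norm (x - y))) \<le> indicator S y"
      by (metis ennreal_indicator ennreal_leI)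
    then show ?thesis by (meson add_increasing zero_le)
  next
    case False
    define r where "r = norm (x - y)"
    have r: "0 < r" "r < 1" using False by (auto simp: r_def)
    obtain n where n: "(1/2) ^ n < r" using real_arch_pow_inv[of r "1/2"] r by auto
    \<comment> \<open>The least such exponent is one more than the index \<open>k\<close> of the
      annulus containing \<open>y\<close>; it is positive because \<open>r < 1\<close>.\<close>
    define m where "m = (LEAST n. (1/2::real) ^ n < r)"
    have m: "(1/2) ^ m < r" unfolding m_def by (rule LeastI, rule n)
    have "m \<noteq> 0" using m r by (intro notI) simp
    then obtain k where k: "m = Suc k" using not0_implies_Suc by blast
    have "\<not> (1/2) ^ k < r" using not_less_Least[of k "\<lambda>n. (1/2::real) ^ n < r"] k by (simp add: m_def)
    then have "y \<in> cball x ((1/2) ^ k)" by (simp add: r_def dist_norm)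
    moreover have "1 / r \<le> 2 ^ Suc k"
      using m r unfolding k by (simp add: field_simps power_one_over)
    ultimately have "ennreal (indicator S y * (1 / norm (x - y))) \<le> ?g k y"
      using False by (auto simp: r_def[symmetric] intro!: ennreal_leI)
    also have "\<dots> = (\<Sum>i\<in>{k}. ?g i y)" by (simp only: sum.insert sum.empty finite.emptyI empty_iff not_False_eq_True add_0_right)
    also have "\<dots> \<le> (\<Sum>i. ?g i y)"
      by (rule sum_le_suminf) auto
    finally show ?thesis by (simp add: add_increasing2)
  qed
  have "(\<integral>\<^sup>+ y. ennreal (indicator S y * (1 / norm (x - y))) \<partial>lborel)
      \<le> (\<integral>\<^sup>+ y. (\<Sum>k. ?g k y) + indicator S y \<partial>lborel)"
    by (intro nn_integral_mono pw)
  also have "\<dots> = (\<Sum>k. \<integral>\<^sup>+ y. ?g k y \<partial>lborel) + emeasure lborel S"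
    by (subst nn_integral_add, simp_all only: nn_integral_suminf[OF g] nn_integral_indicator assms sets_lborel)
      (use g in measurable)
  also have "(\<Sum>k. \<integral>\<^sup>+ y. ?g k y \<partial>lborel) = (\<Sum>k. ennreal (2 * pi * (1/2) ^ k))"
  proof (rule suminf_cong)
    fix k
    have "(\<integral>\<^sup>+ y. ?g k y \<partial>lborel) = ennreal (2 ^ Suc k) * emeasure lborel (cball x ((1/2) ^ k))"
      by (simp add: nn_integral_cmult_indicator)
    also have "\<dots> = ennreal (2 ^ Suc k * (pi * ((1/2) ^ k)\<^sup>2))"
      by (simp add: emeasure_cball unit_ball_vol_2 flip: ennreal_mult)
    also have "2 ^ Suc k * (pi * ((1/2) ^ k)\<^sup>2) = 2 * pi * (1/2) ^ k"
      by (simp add: power2_eq_square field_simps power_one_over)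
    finally show "(\<integral>\<^sup>+ y. ?g k y \<partial>lborel) = ennreal (2 * pi * (1/2) ^ k)" .
  qed
  also have "\<dots> = ennreal (\<Sum>k. 2 * pi * (1/2) ^ k)"
    by (rule suminf_ennreal2) (auto intro!: summable_mult summable_geometric)
  also have "(\<Sum>k. 2 * pi * (1/2::real) ^ k) = 4 * pi"
    by (subst suminf_mult) (auto simp: suminf_geometric)
  finally show ?thesis .
qed

lemma inverse_norm_integrable:
  fixes x :: "real ^ 2"
  assumes "bounded S" and S: "S \<in> sets borel"
  shows "integrable lborel (\<lambda>y. indicator S y * (1 / norm (x - y)))" (is ?I)
    and "(\<integral>y. indicator S y * (1 / norm (x - y)) \<partial>lborel) \<le> 4 * pi + measure lborel S" (is ?B)
proof -
  have [measurable]: "S \<in> sets borel" by fact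
  have fin: "emeasure lborel S < \<infinity>" by (rule emeasure_bounded_finite) fact
  then have S': "emeasure lborel S = ennreal (measure lborel S)"
    by (simp add: emeasure_eq_ennreal_measure)
  have le: "(\<integral>\<^sup>+ y. ennreal (indicator S y * (1 / norm (x - y))) \<partial>lborel)
      \<le> ennreal (4 * pi + measure lborel S)"
    using nn_integral_inverse_norm_le[OF S, of x] by (simp add: S' ennreal_plus)
  show I: ?I
    by (rule integrableI_bounded)
      (use le in \<open>auto simp: top_unique less_top abs_mult intro: le_less_trans\<close>)
  show ?B
  proof -
    have "ennreal (\<integral>y. indicator S y * (1 / norm (x - y)) \<partial>lborel) \<le> ennreal (4 * pi + measure lborel S)"
      using le by (subst (asm) nn_integral_eq_integral[OF I]) auto
    then show ?thesis by (subst (asm) ennreal_le_iff) auto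
  qed
qed

text \<open>At \<open>r = 0\<close> both sides vanish by \<open>ln 0 = 0\<close> and
  \<open>1 / 0 = 0\<close>, so the kernel \<open>1 / |x - y|\<close> helps to dominate the logarithm
  without an exception at \<open>y = x\<close>.\<close>

lemma abs_ln_le:
  fixes r :: real
  assumes "r \<ge> 0"
  shows "\<bar>ln r\<bar> \<le> r + 1 / r"
proof (cases "r = 0")
  case False
  then have r: "r > 0" using assms by simp
  have "ln r \<le> r" using ln_le_minus_one[OF r] by simp
  moreover have "- ln r \<le> 1 / r" using ln_le_minus_one[of "1 / r"] r by (simp add: ln_div)
  moreover have "1 / r > 0" using r by simp
  ultimately show ?thesis using r by linarith
qed simp

lemma ln_norm_integrable:
  fixes x :: "real ^ 2"
  assumes "bounded S" and S: "S \<in> sets borel"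
  shows "integrable lborel (\<lambda>y. indicator S y * ln (norm (x - y)))"
proof -
  have [measurable]: "S \<in> sets borel" by fact
  obtain B where B: "\<And>y. y \<in> S \<Longrightarrow> norm y \<le> B" using assms(1) by (auto simp: bounded_iff)
  have fin: "emeasure lborel S < \<infinity>" by (rule emeasure_bounded_finite) fact
  have "integrable lborel (\<lambda>y. (norm x + B) * indicator S y + indicator S y * (1 / norm (x - y)))"
    by (intro Bochner_Integration.integrable_add inverse_norm_integrable assms integrable_mult_right
        integrable_real_indicator fin) simp
  then show ?thesis
  proof (rule Bochner_Integration.integrable_bound)
    show "AE y in lborel. norm (indicator S y * ln (norm (x - y)))
        \<le> norm ((norm x + B) * indicator S y + indicator S y * (1 / norm (x - y)))"
    proof (rule AE_I2)
      fix y
      show "norm (indicator S y * ln (norm (x - y)))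
        \<le> norm ((norm x + B) * indicator S y + indicator S y * (1 / norm (x - y)))"
      proof (cases "y \<in> S")
        case True
        have "norm (x - y) \<le> norm x + B" using norm_triangle_ineq4[of x y] B[OF True] by linarith
        then have "\<bar>ln (norm (x - y))\<bar> \<le> norm x + B + 1 / norm (x - y)"
          using abs_ln_le[of "norm (x - y)"] by simp
        then show ?thesis using True by simp
      qed simp
    qed
  qed measurable
qed

section \<open>The stream function: Lipschitz bound and comparison under reflection\<close>

text \<open>Passes from the gauge integral of the definition to the Lebesgue integral, where
  invariance of the measure and almost-everywhere estimates are available.\<close>

lemma stream_fn_eq_lborel:
  assumes "bounded D" "D \<in> sets borel"
  shows "stream_fn D x = (1 / (2 * pi)) * (\<integral>y. indicator D y * ln (norm (x - y)) \<partial>lborel)"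
proof -
  have "integral D (\<lambda>y. ln (norm (x - y))) = integral UNIV (\<lambda>y. indicator D y * ln (norm (x - y)))"
    by (subst integral_restrict_UNIV[symmetric]) (auto intro!: integral_cong simp: indicator_def)
  then show ?thesis
    unfolding stream_fn_def by (simp add: integral_lborel[OF ln_norm_integrable[OF assms]])
qed

text \<open>Apply \<open>ln t \<le> t - 1\<close> to \<open>t = a / b\<close> and to
  \<open>t = b / a\<close>; the symmetric factor covers both cases.\<close>

lemma abs_ln_diff_le:
  fixes a b :: real
  assumes "a > 0" "b > 0"
  shows "\<bar>ln a - ln b\<bar> \<le> \<bar>a - b\<bar> * (1 / a + 1 / b)"
proof -
  have *: "ln u - ln v \<le> \<bar>u - v\<bar> * (1 / u + 1 / v)" if "u > 0" "v > 0" for u v :: real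
  proof -
    have "ln u - ln v = ln (u / v)" using that by (simp add: ln_div)
    also have "\<dots> \<le> u / v - 1" using that by (intro ln_le_minus_one) simp
    also have "\<dots> = (u - v) * (1 / v)" using that by (simp add: field_simps)
    also have "\<dots> \<le> \<bar>u - v\<bar> * (1 / u + 1 / v)" using that by (intro mult_mono) auto
    finally show ?thesis .
  qed
  show ?thesis
    using *[OF assms] *[OF assms(2,1)]
    by (simp add: abs_le_iff abs_minus_commute[of b] add.commute[of "1 / b"])
qed

text \<open>The kernel difference is at most \<open>|x - z|\<close> times two inverse distances,
  each with integral at most \<open>M\<close> whatever the base point; the factor
  \<open>1 / (2 * pi)\<close> turns \<open>2 * M\<close> into \<open>M / pi\<close>.\<close>

lemma stream_fn_lipschitz:
  assumes "bounded D" and D: "D \<in> sets borel"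
  shows "\<exists>L\<ge>0. \<forall>x z. \<bar>stream_fn D x - stream_fn D z\<bar> \<le> L * norm (x - z)"
proof -
  define M where "M = 4 * pi + measure lborel D"
  have [measurable]: "D \<in> sets borel" by fact
  have "\<bar>stream_fn D x - stream_fn D z\<bar> \<le> (M / pi) * norm (x - z)" for x z
  proof -
    let ?i = "\<lambda>x y. indicator D y * (1 / norm (x - y)) :: real"
    let ?l = "\<lambda>x y. indicator D y * ln (norm (x - y)) :: real"
    note int = inverse_norm_integrable[OF assms] ln_norm_integrable[OF assms]
    \<comment> \<open>At \<open>y = x\<close> or \<open>y = z\<close> a distance vanishes and the
      logarithm bound does not apply; these points form a null set.\<close>
    have pw: "\<bar>?l x y - ?l z y\<bar> \<le> norm (x - z) * (?i x y + ?i z y)" if "y \<noteq> x" "y \<noteq> z" for y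
    proof -
      have "\<bar>ln (norm (x - y)) - ln (norm (z - y))\<bar>
          \<le> \<bar>norm (x - y) - norm (z - y)\<bar> * (1 / norm (x - y) + 1 / norm (z - y))"
        using that by (intro abs_ln_diff_le) auto
      also have "\<dots> \<le> norm (x - z) * (1 / norm (x - y) + 1 / norm (z - y))"
        using norm_triangle_ineq3[of "x - y" "z - y"] by (intro mult_right_mono) auto
      finally show ?thesis by (auto simp: indicator_def)
    qed
    have "\<bar>(\<integral>y. ?l x y \<partial>lborel) - (\<integral>y. ?l z y \<partial>lborel)\<bar> = \<bar>\<integral>y. ?l x y - ?l z y \<partial>lborel\<bar>"
      by (simp add: int)
    also have "\<dots> \<le> (\<integral>y. \<bar>?l x y - ?l z y\<bar> \<partial>lborel)" by (rule integral_abs_bound)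
    also have "\<dots> \<le> (\<integral>y. norm (x - z) * (?i x y + ?i z y) \<partial>lborel)"
    proof (rule integral_mono_AE)
      show "AE y in lborel. \<bar>?l x y - ?l z y\<bar> \<le> norm (x - z) * (?i x y + ?i z y)"
        using AE_lborel_singleton[of x] AE_lborel_singleton[of z]
        by eventually_elim (rule pw, auto)
    qed (intro integrable_abs Bochner_Integration.integrable_diff
          integrable_mult_right Bochner_Integration.integrable_add int)+
    also have "\<dots> = norm (x - z) * ((\<integral>y. ?i x y \<partial>lborel) + (\<integral>y. ?i z y \<partial>lborel))"
      by (subst integral_mult_right_zero, subst Bochner_Integration.integral_add) (simp_all only: int)
    also have "\<dots> \<le> norm (x - z) * (M + M)"
      unfolding M_def by (intro mult_left_mono add_mono int) auto
    finally have "\<bar>(\<integral>y. ?l x y \<partial>lborel) - (\<integral>y. ?l z y \<partial>lborel)\<bar> \<le> norm (x - z) * (M + M)" .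
    then have "\<bar>(\<integral>y. ?l x y \<partial>lborel) - (\<integral>y. ?l z y \<partial>lborel)\<bar> / (2 * pi)
        \<le> norm (x - z) * (M + M) / (2 * pi)"
      by (rule divide_right_mono) simp
    moreover have "\<bar>stream_fn D x - stream_fn D z\<bar>
        = \<bar>(\<integral>y. ?l x y \<partial>lborel) - (\<integral>y. ?l z y \<partial>lborel)\<bar> / (2 * pi)"
      unfolding stream_fn_eq_lborel[OF assms] right_diff_distrib[symmetric] by (simp add: abs_mult)
    ultimately show ?thesis by (simp add: field_simps)
  qed
  moreover have "M / pi \<ge> 0" by (simp add: M_def)
  ultimately show ?thesis by blast
qed

text \<open>\<open>F\<close> and its composition with the reflection have the same integral, so it
  is enough that their sum is nonnegative. The kernel difference \<open>f\<close> is odd under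
  reflection and nonnegative on the side \<open>y \<bullet> e \<le> l\<close>; by
  \<open>cap\<close>, a negative contribution from the other side is always cancelled by its mirror
  image.\<close>

lemma stream_fn_reflection_le:
  assumes "bounded D" and D: "D \<in> sets borel" and e: "norm e = 1"
    and cap: "\<And>y. y \<in> D \<Longrightarrow> y \<bullet> e > l \<Longrightarrow> reflection e l y \<in> D"
    and x: "x \<bullet> e \<ge> l"
  shows "stream_fn D (reflection e l x) \<le> stream_fn D x"
proof -
  have [measurable]: "D \<in> sets borel" by fact
  have R[measurable]: "reflection e l \<in> borel_measurable borel"
    by (intro borel_measurable_continuous_onI continuous_on_reflection)
  let ?R = "reflection e l"
  define f where "f y = ln (norm (x - y)) - ln (norm (?R x - y))" for y
  define F where "F y = indicator D y * f y" for y
  have F: "F y = indicator D y * ln (norm (x - y)) - indicator D y * ln (norm (?R x - y))" for y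
    by (simp add: F_def f_def right_diff_distrib)
  have intF: "integrable lborel F"
    unfolding F by (intro Bochner_Integration.integrable_diff ln_norm_integrable assms)
  then have [measurable]: "F \<in> borel_measurable borel" by auto
  have intFR: "integrable lborel (\<lambda>y. F (?R y))"
    using intF integrable_distr_eq[of ?R lborel borel F] lborel_distr_reflection[OF e, of l] by simp
  have eqFR: "(\<integral>y. F (?R y) \<partial>lborel) = (\<integral>y. F y \<partial>lborel)"
    using integral_distr[of ?R lborel borel F] lborel_distr_reflection[OF e, of l] by simp
  have anti: "f (?R y) = - f y" for y
    unfolding f_def norm_reflection_diff_commute[OF e, symmetric] reflection_involution[OF e]
    using norm_reflection_diff_commute[OF e, of l "?R x" y] by (simp add: reflection_involution[OF e])
  \<comment> \<open>The point \<open>R x\<close> is excluded because \<open>ln 0 = 0\<close> may give the wrong sign there.\<close>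
  have pos: "f y \<ge> 0" if "y \<bullet> e \<le> l" "y \<noteq> ?R x" for y
  proof -
    have "(x \<bullet> e - l) * (y \<bullet> e - l) \<le> 0" using x that by (simp add: mult_nonneg_nonpos)
    then have "(norm (?R x - y))\<^sup>2 \<le> (norm (x - y))\<^sup>2"
      unfolding norm_diff_reflection[OF e] mult.assoc by simp
    then have "norm (?R x - y) \<le> norm (x - y)" by (rule power2_le_imp_le) simp
    then show ?thesis unfolding f_def using that by (simp add: ln_mono)
  qed
  have sum_nonneg: "F y + F (?R y) \<ge> 0" if "y \<bullet> e \<le> l" "y \<noteq> ?R x" for y
  proof (cases "y \<bullet> e = l")
    case True
    then have "?R y = y" by (simp add: reflection_def)
    then show ?thesis using anti[of y] by (simp add: F_def)
  next
    case False
    then have "?R y \<bullet> e > l" using that by (simp add: inner_reflection[OF e])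
    then have "?R y \<in> D \<Longrightarrow> y \<in> D" using cap[of "?R y"] by (simp add: reflection_involution[OF e])
    then show ?thesis using pos[OF that] by (auto simp: F_def anti indicator_def)
  qed
  \<comment> \<open>Beyond the line the roles of \<open>y\<close> and \<open>?R y\<close> are
    exchanged, so the point to exclude there is \<open>x\<close>.\<close>
  have "AE y in lborel. F y + F (?R y) \<ge> 0"
    using AE_lborel_singleton[of x] AE_lborel_singleton[of "?R x"]
  proof eventually_elim
    case (elim y)
    show ?case
    proof (cases "y \<bullet> e \<le> l")
      case True
      then show ?thesis using elim sum_nonneg by blast
    next
      case False
      then have "?R y \<bullet> e \<le> l" by (simp add: inner_reflection[OF e])
      moreover have "?R y \<noteq> ?R x" using elim by (metis reflection_involution[OF e])
      ultimately show ?thesis using sum_nonneg[of "?R y"] by (simp add: reflection_involution[OF e])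
    qed
  qed
  then have "0 \<le> (\<integral>y. F y + F (?R y) \<partial>lborel)" by (rule integral_nonneg_AE)
  also have "\<dots> = 2 * (\<integral>y. F y \<partial>lborel)"
    by (simp add: intF intFR eqFR)
  also have "(\<integral>y. F y \<partial>lborel) = 2 * pi * (stream_fn D x - stream_fn D (?R x))"
    unfolding F stream_fn_eq_lborel[OF assms(1,2)]
    by (subst Bochner_Integration.integral_diff)
      (auto intro!: ln_norm_integrable assms simp: field_simps)
  finally show ?thesis using pi_gt_zero by (simp add: zero_le_mult_iff)
qed

section \<open>Local geometry of a domain with \<open>C^1\<close> boundary\<close>

text \<open>By continuity \<open>g > 0\<close> defines an open set; it misses \<open>D\<close>,
  hence also \<open>closure D\<close>. A frontier point of the open set \<open>D\<close> lies in
  \<open>closure D\<close> but not in \<open>D\<close>, which forces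
  \<open>g x0 = 0\<close>.\<close>

lemma C1_boundary_defining_function:
  assumes "C1_boundary D" "open D" "x0 \<in> frontier D"
  obtains U g G where "open U" "x0 \<in> U" "continuous_on U G"
    "\<And>x. x \<in> U \<Longrightarrow> (g has_derivative (\<lambda>h. G x \<bullet> h)) (at x)"
    "G x0 \<noteq> 0" "\<And>x. x \<in> U \<Longrightarrow> x \<in> D \<longleftrightarrow> g x < 0" "g x0 = 0"
    "\<And>x. x \<in> U \<Longrightarrow> x \<in> closure D \<Longrightarrow> g x \<le> 0"
proof -
  obtain nu where "outward_normal D x0 nu"
    using assms(1,3) unfolding C1_boundary_def by blast
  then obtain U g G where U: "open U" "x0 \<in> U" "continuous_on U G"
    and der: "\<And>x. x \<in> U \<Longrightarrow> (g has_derivative (\<lambda>h. G x \<bullet> h)) (at x)"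
    and G: "G x0 \<noteq> 0" and DU: "D \<inter> U = {x\<in>U. g x < 0}"
    unfolding outward_normal_def by blast
  have mem: "x \<in> D \<longleftrightarrow> g x < 0" if "x \<in> U" for x using DU that by blast
  have le: "g x \<le> 0" if x: "x \<in> U" "x \<in> closure D" for x
  proof (rule ccontr)
    assume pos: "\<not> g x \<le> 0"
    have "continuous_on U g"
      by (rule has_derivative_continuous_on, rule has_derivative_at_withinI, rule der)
    then have "open (g -` {0<..} \<inter> U)"
      using continuous_on_open_vimage[OF U(1)] open_greaterThan by blast
    moreover have "x \<in> g -` {0<..} \<inter> U" using pos x by simp
    ultimately have "D \<inter> (g -` {0<..} \<inter> U) \<noteq> {}"
      using x(2) unfolding closure_iff_nhds_not_empty by blast
    then show False using mem by force
  qed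
  have "x0 \<notin> D" "x0 \<in> closure D"
    using assms(2,3) by (simp_all add: frontier_def interior_open)
  then have "g x0 = 0" using mem[OF U(2)] le[OF U(2)] by simp
  with that[OF U der G mem _ le] show thesis by blast
qed

text \<open>Along the line through \<open>x\<close> in direction \<open>d\<close> the function
  \<open>g\<close> has derivative \<open>v \<bullet> d\<close> at 0, so it changes sign
  there.\<close>

lemma has_derivative_inner_eventually_pos:
  assumes "(g has_derivative (\<lambda>h. v \<bullet> h)) (at x)" and "v \<bullet> d > 0" and "g x = 0"
  shows "\<forall>\<^sub>F t in at_right (0::real). g (x + t *\<^sub>R d) > 0"
    and "\<forall>\<^sub>F t in at_right (0::real). g (x - t *\<^sub>R d) < 0"
proof -
  have der: "((\<lambda>t. g (x + t *\<^sub>R w)) has_real_derivative v \<bullet> w) (at 0)" for w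
  proof -
    have "((\<lambda>t. g (x + t *\<^sub>R w)) has_derivative (\<lambda>t. v \<bullet> (t *\<^sub>R w))) (at 0)"
      by (rule has_derivative_compose[of "\<lambda>t. x + t *\<^sub>R w" "\<lambda>t. t *\<^sub>R w" 0 UNIV g "\<lambda>h. v \<bullet> h"])
        (auto intro!: derivative_eq_intros assms)
    then show ?thesis unfolding has_field_derivative_def by (simp add: mult_commute_abs)
  qed
  obtain d1 where d1: "d1 > 0" "\<forall>h>0. h < d1 \<longrightarrow> g (x + (0 + h) *\<^sub>R d) > g (x + 0 *\<^sub>R d)"
    using DERIV_pos_inc_right[OF der] assms(2) by metis
  show "\<forall>\<^sub>F t in at_right (0::real). g (x + t *\<^sub>R d) > 0"
    unfolding eventually_at_right_field using d1 assms(3) by auto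
  have "v \<bullet> (- d) < 0" using assms(2) by simp
  then obtain d2 where d2: "d2 > 0" "\<forall>h>0. h < d2 \<longrightarrow> g (x + (0 + h) *\<^sub>R (- d)) < g (x + 0 *\<^sub>R (- d))"
    using DERIV_neg_dec_right[OF der] by metis
  show "\<forall>\<^sub>F t in at_right (0::real). g (x - t *\<^sub>R d) < 0"
    unfolding eventually_at_right_field using d2 assms(3) by auto
qed

lemma eventually_at_right_line:
  fixes x d :: "'a::real_normed_vector"
  assumes "open U" "x \<in> U"
  shows "\<forall>\<^sub>F t in at_right (0::real). x + t *\<^sub>R d \<in> U"
proof -
  have "((\<lambda>t. x + t *\<^sub>R d) \<longlongrightarrow> x + 0 *\<^sub>R d) (at_right 0)" by (intro tendsto_intros)
  then show ?thesis using assms by (simp add: topological_tendstoD)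
qed

text \<open>Such a domain has no slits or punctures: from a frontier point, a small step along the
  gradient makes \<open>g\<close> positive and so leaves \<open>closure D\<close>. This allows a
  return from \<open>closure D\<close> to \<open>D\<close> after a limit.\<close>

lemma C1_boundary_interior_closure:
  assumes "C1_boundary D" "open D"
  shows "interior (closure D) \<subseteq> D"
proof
  fix x assume x: "x \<in> interior (closure D)"
  show "x \<in> D"
  proof (rule ccontr)
    assume "x \<notin> D"
    then have fx: "x \<in> frontier D"
      using x interior_subset assms(2) by (auto simp: frontier_def interior_open)
    obtain U g G where U: "open U" "x \<in> U" and "continuous_on U G"
      and der: "\<And>x. x \<in> U \<Longrightarrow> (g has_derivative (\<lambda>h. G x \<bullet> h)) (at x)"
      and G: "G x \<noteq> 0" and g0: "g x = 0" and le: "\<And>x. x \<in> U \<Longrightarrow> x \<in> closure D \<Longrightarrow> g x \<le> 0"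
      using C1_boundary_defining_function[OF assms fx] by metis
    have "\<forall>\<^sub>F t in at_right (0::real). g (x + t *\<^sub>R G x) > 0"
      by (rule has_derivative_inner_eventually_pos(1)[OF der[OF U(2)] _ g0]) (simp add: G)
    moreover have "\<forall>\<^sub>F t in at_right (0::real). x + t *\<^sub>R G x \<in> U \<inter> interior (closure D)"
      by (rule eventually_at_right_line) (use U x in auto)
    ultimately have "\<forall>\<^sub>F t in at_right (0::real). \<exists>y. y \<in> U \<inter> interior (closure D) \<and> g y > 0"
      by eventually_elim blast
    then obtain y where y: "y \<in> U" "y \<in> interior (closure D)" "g y > 0"
      by auto
    then show False using le[of y] interior_subset by fastforce
  qed
qed

text \<open>The boundary is a graph over its tangent line: a displacement \<open>t\<close> along a tangent vector
  needs a normal correction of only \<open>o(t)\<close>.\<close>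

lemma frontier_near_tangent:
  fixes g :: "'a::real_inner \<Rightarrow> real"
  assumes U: "open U" "x \<in> U"
    and der: "(g has_derivative (\<lambda>h. v \<bullet> h)) (at x)" and v: "v \<noteq> 0" and g0: "g x = 0"
    and DU: "\<And>x. x \<in> U \<Longrightarrow> x \<in> D \<longleftrightarrow> g x < 0"
    and d: "v \<bullet> d = 0" and eps: "\<epsilon> > 0"
  shows "\<forall>\<^sub>F t in at_right (0::real). \<exists>s. \<bar>s\<bar> \<le> \<epsilon> * t \<and> x + t *\<^sub>R d + s *\<^sub>R v \<in> frontier D"
proof -
  have vv: "v \<bullet> v > 0" using v by simp
  \<comment> \<open>Tilting the tangent direction by \<open>\<epsilon>\<close> to either side gives
    slopes of opposite sign. The normal segment between the two tilted points thus joins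
    \<open>D\<close> to its complement and, being connected, meets the frontier.\<close>
  have "\<forall>\<^sub>F t in at_right (0::real). g (x + t *\<^sub>R (d + \<epsilon> *\<^sub>R v)) > 0"
    by (rule has_derivative_inner_eventually_pos(1)[OF der _ g0])
      (use d eps vv in \<open>simp add: inner_add_right\<close>)
  moreover have "\<forall>\<^sub>F t in at_right (0::real). g (x - t *\<^sub>R (\<epsilon> *\<^sub>R v - d)) < 0"
    by (rule has_derivative_inner_eventually_pos(2)[OF der _ g0])
      (use d eps vv in \<open>simp add: inner_diff_right\<close>)
  moreover have "\<forall>\<^sub>F t in at_right (0::real). x + t *\<^sub>R (d + \<epsilon> *\<^sub>R v) \<in> U"
    "\<forall>\<^sub>F t in at_right (0::real). x + t *\<^sub>R (d - \<epsilon> *\<^sub>R v) \<in> U"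
    by (rule eventually_at_right_line[OF U])+
  moreover have "\<forall>\<^sub>F t in at_right (0::real). t > 0"
    by (simp add: eventually_at_right_less)
  ultimately show ?thesis
  proof eventually_elim
    case (elim t)
    let ?p = "\<lambda>s. x + t *\<^sub>R d + s *\<^sub>R v"
    let ?S = "?p ` {- (\<epsilon> * t)..\<epsilon> * t}"
    have "connected ?S" by (intro connected_continuous_image continuous_intros) simp
    moreover have "?p (- (\<epsilon> * t)) \<in> D"
    proof -
      have "?p (- (\<epsilon> * t)) = x + t *\<^sub>R (d - \<epsilon> *\<^sub>R v)" "?p (- (\<epsilon> * t)) = x - t *\<^sub>R (\<epsilon> *\<^sub>R v - d)"
        by (simp_all add: algebra_simps)
      then show ?thesis using elim DU by metis
    qed
    moreover have "?p (\<epsilon> * t) \<notin> D"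
    proof -
      have "?p (\<epsilon> * t) = x + t *\<^sub>R (d + \<epsilon> *\<^sub>R v)" by (simp add: algebra_simps)
      then show ?thesis using elim DU by (metis less_asym)
    qed
    moreover have "?p (- (\<epsilon> * t)) \<in> ?S" "?p (\<epsilon> * t) \<in> ?S"
      by (rule imageI, use elim eps in simp)+
    ultimately have "?S \<inter> frontier D \<noteq> {}"
      by (intro connected_Int_frontier) blast+
    then show ?case by (force simp: abs_le_iff)
  qed
qed

section \<open>The moving plane argument\<close>

text \<open>Potential theory enters through \<open>refl\<close> and \<open>lip\<close> alone. The
  assumption \<open>refl\<close> ranges over all positions of the line because it is applied at the
  critical one, which is found inside the proof.\<close>

lemma moving_plane:
  fixes D :: "pt set" and \<phi> :: "pt \<Rightarrow> real"
  assumes D: "bounded D" "open D" "C1_boundary D" and e: "norm e = 1"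
    and lip: "\<And>x z. x \<in> closure D \<Longrightarrow> z \<in> closure D \<Longrightarrow> \<bar>\<phi> x - \<phi> z\<bar> \<le> L * norm (x - z)"
    and const: "\<And>x. x \<in> frontier D \<Longrightarrow> \<phi> x = \<mu>"
    and c: "c > 0"
    and refl: "\<And>l x. \<lbrakk>l > 0; \<forall>y\<in>D. y \<bullet> e > l \<longrightarrow> reflection e l y \<in> D; x \<bullet> e \<ge> l\<rbrakk>
        \<Longrightarrow> \<phi> x - \<phi> (reflection e l x) \<ge> c * l * (x \<bullet> e - l)"
    and l0: "l0 > 0"
  shows "\<forall>x\<in>D. x \<bullet> e > l0 \<longrightarrow> reflection e l0 x \<in> D"
proof (rule ccontr)
  define P where "P l \<longleftrightarrow> (\<forall>x\<in>D. x \<bullet> e > l \<longrightarrow> reflection e l x \<in> D)" for l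
  assume "\<not> ?thesis"
  then have nP: "\<not> P l0" by (simp add: P_def)
  obtain B where B: "\<And>x. x \<in> D \<Longrightarrow> norm x \<le> B" using D(1) by (auto simp: bounded_iff)
  have bd: "l \<le> B" if nPl: "\<not> P l" for l
  proof -
    obtain x where "x \<in> D" "x \<bullet> e > l" using nPl by (auto simp: P_def)
    then show ?thesis using norm_cauchy_schwarz[of x e] B[of x] e by simp
  qed
  have ne: "{l. \<not> P l} \<noteq> {}" and bdd: "bdd_above {l. \<not> P l}"
    using nP bd by (auto intro!: bdd_aboveI)
  \<comment> \<open>The critical position: the cap property holds beyond \<open>l\<close>, and it
    fails at positions at or arbitrarily close below \<open>l\<close>.\<close>
  define l where "l = Sup {l. \<not> P l}"
  have l: "l > 0" using cSup_upper[OF _ bdd, of l0] nP l0 by (simp add: l_def)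
  have above: "P k" if "k > l" for k
    using cSup_upper[OF _ bdd, of k] that by (force simp: l_def)
  let ?R = "reflection e l"
  have contR: "continuous_on S ?R" for S by (rule continuous_on_reflection)
  \<comment> \<open>Reflections in lines slightly beyond \<open>l\<close> land in \<open>D\<close>;
    the limit is only in \<open>closure D\<close>.\<close>
  have capcl: "?R x \<in> closure D" if "x \<in> D" "x \<bullet> e > l" for x
  proof -
    have "((\<lambda>k. reflection e k x) \<longlongrightarrow> ?R x) (at_right l)"
      unfolding reflection_def by (intro tendsto_intros)
    moreover have "\<forall>\<^sub>F k in at_right l. reflection e k x \<in> closure D"
      unfolding eventually_at_right_field
    proof (intro exI[of _ "x \<bullet> e"] conjI allI impI that)
      fix k assume "k > l" "k < x \<bullet> e"
      then have "reflection e k x \<in> D" using above[of k] that by (simp add: P_def)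
      then show "reflection e k x \<in> closure D" using closure_subset by blast
    qed
    ultimately show ?thesis by (intro Lim_in_closed_set[where F="at_right l"]) auto
  qed
  \<comment> \<open>The mirror image of the open cap is open and contained in
    \<open>closure D\<close>, hence contained in \<open>D\<close>.\<close>
  have Pl: "P l" unfolding P_def
  proof (intro ballI impI)
    fix x assume x: "x \<in> D" "x \<bullet> e > l"
    let ?V = "?R -` (D \<inter> {x. x \<bullet> e > l})"
    have "open (D \<inter> {x. x \<bullet> e > l})"
      using D(2) by (intro open_Int open_Collect_less continuous_intros)
    then have "open ?V" by (intro open_vimage contR)
    moreover have "?V \<subseteq> closure D"
    proof
      fix y assume "y \<in> ?V"
      then show "y \<in> closure D" using capcl[of "?R y"] by (simp add: reflection_involution[OF e])
    qed
    ultimately have "?V \<subseteq> interior (closure D)" by (rule interior_maximal[rotated])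
    then have "?V \<subseteq> D" using C1_boundary_interior_closure[OF D(3,2)] by blast
    then show "?R x \<in> D" using x by (auto simp: reflection_involution[OF e])
  qed
  have refl_l: "\<phi> x - \<phi> (?R x) \<ge> c * l * (x \<bullet> e - l)" if "x \<bullet> e \<ge> l" for x
    using refl[OF l _ that] Pl by (simp add: P_def)
  have clcl: "?R x \<in> closure D" if "x \<in> closure D" "x \<bullet> e \<ge> l" for x
  proof (cases "x \<bullet> e = l")
    case True
    then show ?thesis using that by (simp add: reflection_def)
  next
    case False
    let ?W = "{x. x \<bullet> e > l}"
    have "open ?W" by (intro open_Collect_less continuous_intros)
    then have "x \<in> closure (?W \<inter> D)"
      using open_Int_closure_subset[of ?W D] that False by force
    moreover have "?R ` closure (?W \<inter> D) \<subseteq> closure D"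
      by (rule image_closure_subset[OF contR]) (use capcl in auto)
    ultimately show ?thesis by blast
  qed
  \<comment> \<open>Witnesses of failure at positions \<open>k\<close> tending to \<open>l\<close>;
    compactness then yields a limit point \<open>x\<close>. Both \<open>x\<close> and
    \<open>?R x\<close> turn out to lie on the frontier.\<close>
  have "\<exists>k x. \<bar>k - l\<bar> < 1 / Suc n \<and> x \<in> D \<and> x \<bullet> e > k \<and> reflection e k x \<notin> D" for n
  proof -
    obtain k where "\<not> P k" "k > l - 1 / Suc n"
      using less_cSup_iff[OF ne bdd, of "l - 1 / Suc n"] by (auto simp: l_def)
    moreover then have "k \<le> l" using above by force
    ultimately show ?thesis by (auto simp: P_def intro!: exI[of _ k])
  qed
  then obtain k X where kX: "\<And>n. \<bar>k n - l\<bar> < 1 / Suc n" "\<And>n. X n \<in> D"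
    "\<And>n. X n \<bullet> e > k n" "\<And>n. reflection e (k n) (X n) \<notin> D"
    by metis
  have k: "k \<longlonglongrightarrow> l"
  proof (rule LIM_zero_cancel, rule Lim_null_comparison)
    show "\<forall>\<^sub>F n in sequentially. norm (k n - l) \<le> inverse (Suc n)"
      using kX(1) by (auto simp: divide_inverse intro!: always_eventually less_imp_le)
  qed (rule LIMSEQ_inverse_real_of_nat)
  have "compact (closure D)" using D(1) by simp
  moreover have "\<forall>n. X n \<in> closure D" using kX(2) closure_subset by blast
  ultimately obtain x r where x: "x \<in> closure D" and r: "strict_mono r" and Xr: "(X \<circ> r) \<longlonglongrightarrow> x"
    unfolding compact_def by metis
  have kr: "(k \<circ> r) \<longlonglongrightarrow> l" using k r by (rule LIMSEQ_subseq_LIMSEQ)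
  define Y where "Y n = reflection e (k (r n)) (X (r n))" for n
  have Y: "Y \<longlonglongrightarrow> ?R x"
    using Xr kr unfolding Y_def reflection_def o_def by (intro tendsto_intros)
  have xl: "x \<bullet> e \<ge> l"
  proof (rule LIMSEQ_le[OF kr])
    show "(\<lambda>n. (X \<circ> r) n \<bullet> e) \<longlonglongrightarrow> x \<bullet> e" using Xr by (intro tendsto_intros)
    show "\<exists>N. \<forall>n\<ge>N. (k \<circ> r) n \<le> (X \<circ> r) n \<bullet> e" using kX(3) by (auto intro: less_imp_le)
  qed
  have "?R x \<in> - D"
    by (rule Lim_in_closed_set[OF _ _ _ Y]) (use D(2) kX(4) in \<open>auto simp: Y_def\<close>)
  then have RxF: "?R x \<in> frontier D"
    using clcl[OF x xl] D(2) by (simp add: frontier_def interior_open)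
  have "x \<notin> D"
  proof
    assume "x \<in> D"
    then have "?R x \<in> D"
      using Pl xl by (cases "x \<bullet> e = l") (auto simp: P_def reflection_def)
    then show False using \<open>?R x \<in> - D\<close> by simp
  qed
  then have xF: "x \<in> frontier D" using x D(2) by (simp add: frontier_def interior_open)
  \<comment> \<open>Since \<open>\<phi>\<close> takes the same value at both points, the
    quantitative comparison forces \<open>x\<close> onto the line.\<close>
  have "c * l * (x \<bullet> e - l) \<le> 0"
    using refl_l[OF xl] const[OF xF] const[OF RxF] by simp
  then have xe: "x \<bullet> e = l" using c l xl by (simp add: mult_le_0_iff)
  then have Rx: "?R x = x" by (simp add: reflection_def)
  obtain U g G where U: "open U" "x \<in> U" and contG: "continuous_on U G"
    and der: "\<And>x. x \<in> U \<Longrightarrow> (g has_derivative (\<lambda>h. G x \<bullet> h)) (at x)"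
    and G: "G x \<noteq> 0" and DU: "\<And>x. x \<in> U \<Longrightarrow> x \<in> D \<longleftrightarrow> g x < 0" and g0: "g x = 0"
    using C1_boundary_defining_function[OF D(3,2) xF] by metis
  note derx = der[OF U(2)]
  \<comment> \<open>Otherwise \<open>g\<close> increases in direction \<open>e\<close> near
    \<open>x\<close>. But the witness \<open>b\<close> lies in \<open>D\<close>, while its
    reflection \<open>a\<close>, which is behind it along \<open>e\<close>, does not, so
    \<open>g b < 0 \<le> g a\<close>.\<close>
  have "\<not> G x \<bullet> e > 0"
  proof
    assume "G x \<bullet> e > 0"
    define W where "W = U \<inter> (\<lambda>y. G y \<bullet> e) -` {0<..}"
    have "continuous_on U (\<lambda>y. G y \<bullet> e)" by (intro continuous_intros contG)
    then have "open W" unfolding W_def using U(1)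
      by (metis Int_commute continuous_on_open_vimage open_greaterThan)
    moreover have "x \<in> W" using U \<open>G x \<bullet> e > 0\<close> by (simp add: W_def)
    ultimately obtain \<rho> where \<rho>: "\<rho> > 0" "ball x \<rho> \<subseteq> W" using open_contains_ball by blast
    have "\<forall>\<^sub>F n in sequentially. (X \<circ> r) n \<in> ball x \<rho>" "\<forall>\<^sub>F n in sequentially. Y n \<in> ball x \<rho>"
      using topological_tendstoD[OF Xr open_ball] topological_tendstoD[OF Y open_ball] \<rho> Rx by auto
    then have "\<forall>\<^sub>F n in sequentially. (X \<circ> r) n \<in> ball x \<rho> \<and> Y n \<in> ball x \<rho>"
      by (rule eventually_conj)
    then obtain n where n: "X (r n) \<in> ball x \<rho>" "Y n \<in> ball x \<rho>"
      by (auto simp: eventually_sequentially)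
    define a b where "a = Y n" and "b = X (r n)"
    define t where "t = 2 * (b \<bullet> e - k (r n))"
    have t: "t > 0" using kX(3) by (simp add: t_def b_def)
    have ba: "b = a + t *\<^sub>R e" by (simp add: a_def b_def t_def Y_def reflection_def)
    have seg: "a + s *\<^sub>R e \<in> W" if "0 \<le> s" "s \<le> t" for s
    proof -
      have "a + s *\<^sub>R e = (1 - s / t) *\<^sub>R a + (s / t) *\<^sub>R b"
        using t by (simp add: ba algebra_simps)
      also have "\<dots> \<in> ball x \<rho>"
        using n that t by (intro convexD convex_ball) (auto simp: a_def b_def)
      finally show ?thesis using \<rho> by blast
    qed
    have "g (a + 0 *\<^sub>R e) < g (a + t *\<^sub>R e)"
    proof (rule DERIV_pos_imp_increasing[OF t])
      fix s assume s: "0 \<le> s" "s \<le> t"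
      have "((\<lambda>s. g (a + s *\<^sub>R e)) has_derivative (\<lambda>h. G (a + s *\<^sub>R e) \<bullet> (h *\<^sub>R e))) (at s)"
        by (rule has_derivative_compose[of "\<lambda>s. a + s *\<^sub>R e" "\<lambda>h. h *\<^sub>R e"])
          (use seg[OF s] in \<open>auto intro!: derivative_eq_intros der simp: W_def\<close>)
      then have "((\<lambda>s. g (a + s *\<^sub>R e)) has_real_derivative G (a + s *\<^sub>R e) \<bullet> e) (at s)"
        unfolding has_field_derivative_def by (simp add: mult_commute_abs)
      then show "\<exists>y. ((\<lambda>s. g (a + s *\<^sub>R e)) has_real_derivative y) (at s) \<and> y > 0"
        using seg[OF s] by (auto simp: W_def)
    qed
    moreover have "a \<in> U" "b \<in> U" using seg[of 0] seg[of t] t by (auto simp: ba W_def)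
    moreover have "b \<in> D" "a \<notin> D" using kX by (simp_all add: a_def b_def Y_def)
    ultimately have "g (a + 0 *\<^sub>R e) < g (a + t *\<^sub>R e)" "g b < 0" "\<not> g a < 0" using DU by auto
    then show False by (simp add: ba)
  qed
  \<comment> \<open>Otherwise, for small \<open>t > 0\<close>, the point \<open>x + t e\<close> is
    in \<open>D\<close> and its mirror image \<open>x - t e\<close> is not, against
    \<open>P l\<close>.\<close>
  moreover have "\<not> G x \<bullet> e < 0"
  proof
    assume neg: "G x \<bullet> e < 0"
    have "\<forall>\<^sub>F t in at_right (0::real). g (x + t *\<^sub>R (- e)) > 0"
      "\<forall>\<^sub>F t in at_right (0::real). g (x - t *\<^sub>R (- e)) < 0"
      by (rule has_derivative_inner_eventually_pos[OF derx _ g0], use neg in simp)+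
    moreover have "\<forall>\<^sub>F t in at_right (0::real). x + t *\<^sub>R (- e) \<in> U"
      "\<forall>\<^sub>F t in at_right (0::real). x + t *\<^sub>R e \<in> U"
      by (rule eventually_at_right_line[OF U])+
    moreover have "\<forall>\<^sub>F t in at_right (0::real). t > 0" by (simp add: eventually_at_right_less)
    ultimately have "\<forall>\<^sub>F t in at_right (0::real). False"
    proof eventually_elim
      case (elim t)
      have ee: "e \<bullet> e = 1" using e by (simp add: norm_eq_1)
      have "x + t *\<^sub>R e \<in> D" using elim DU by simp
      then have "?R (x + t *\<^sub>R e) \<in> D"
        using Pl elim by (simp add: P_def inner_add_left xe ee)
      moreover have "?R (x + t *\<^sub>R e) = x + t *\<^sub>R (- e)"
        by (simp add: reflection_def inner_add_left xe ee algebra_simps flip: scaleR_add_left)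
      ultimately show False using elim DU[of "x + t *\<^sub>R (- e)"] by simp
    qed
    then show False by simp
  qed
  ultimately have Ge: "G x \<bullet> e = 0" by simp
  \<comment> \<open>Chosen so that the Lipschitz error
    \<open>(|L| + 1) * 2 * \<epsilon> * t * norm (G x)\<close> is half of the gain
    \<open>c * l * t\<close>; adding 1 keeps the denominator positive.\<close>
  define \<epsilon> where "\<epsilon> = c * l / (4 * (\<bar>L\<bar> + 1) * norm (G x))"
  have \<epsilon>: "\<epsilon> > 0" using c l G by (simp add: \<epsilon>_def)
  have "\<forall>\<^sub>F t in at_right (0::real). \<exists>s. \<bar>s\<bar> \<le> \<epsilon> * t \<and> x + t *\<^sub>R e + s *\<^sub>R G x \<in> frontier D"
    "\<forall>\<^sub>F t in at_right (0::real). \<exists>s. \<bar>s\<bar> \<le> \<epsilon> * t \<and> x + t *\<^sub>R (- e) + s *\<^sub>R G x \<in> frontier D"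
    by (rule frontier_near_tangent[OF U derx G g0 DU _ \<epsilon>], assumption, simp add: Ge)+
  moreover have "\<forall>\<^sub>F t in at_right (0::real). t > 0" by (simp add: eventually_at_right_less)
  ultimately have "\<forall>\<^sub>F t in at_right (0::real). False"
  proof eventually_elim
    case (elim t)
    obtain s where s: "\<bar>s\<bar> \<le> \<epsilon> * t" "x + t *\<^sub>R e + s *\<^sub>R G x \<in> frontier D" using elim by blast
    obtain s' where s': "\<bar>s'\<bar> \<le> \<epsilon> * t" "x + t *\<^sub>R (- e) + s' *\<^sub>R G x \<in> frontier D" using elim by blast
    \<comment> \<open>The frontier points \<open>z\<close> and \<open>z'\<close> lie near
      \<open>x + t e\<close> and \<open>x - t e\<close>, so \<open>?R z\<close> differs from
      \<open>z'\<close> only by normal corrections, and \<open>\<phi> z = \<phi> z'\<close>.\<close>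
    define z where "z = x + t *\<^sub>R e + s *\<^sub>R G x"
    define z' where "z' = x + t *\<^sub>R (- e) + s' *\<^sub>R G x"
    have ee: "e \<bullet> e = 1" using e by (simp add: norm_eq_1)
    have ze: "z \<bullet> e = l + t" by (simp add: z_def inner_add_left xe ee Ge)
    have "(2 * (l + t - l)) *\<^sub>R e = t *\<^sub>R e + t *\<^sub>R e" by (simp flip: scaleR_add_left)
    then have "?R z = x - t *\<^sub>R e + s *\<^sub>R G x" unfolding reflection_def ze by (simp add: z_def)
    then have Rz: "?R z - z' = (s - s') *\<^sub>R G x" by (simp add: z'_def scaleR_left_diff_distrib)
    have F: "z \<in> frontier D" "z' \<in> frontier D" using s s' by (simp_all add: z_def z'_def)
    then have cl: "z \<in> closure D" "z' \<in> closure D" by (simp_all add: frontier_def)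
    then have "?R z \<in> closure D" using clcl[of z] ze elim by simp
    then have "\<bar>\<phi> (?R z) - \<phi> z'\<bar> \<le> L * norm (?R z - z')" using cl by (intro lip)
    also have "\<dots> \<le> (\<bar>L\<bar> + 1) * norm (?R z - z')" by (intro mult_right_mono) auto
    also have "norm (?R z - z') = \<bar>s - s'\<bar> * norm (G x)" by (simp add: Rz)
    also have "(\<bar>L\<bar> + 1) * (\<bar>s - s'\<bar> * norm (G x)) \<le> (\<bar>L\<bar> + 1) * (2 * (\<epsilon> * t) * norm (G x))"
      using s s' by (intro mult_left_mono mult_right_mono) auto
    also have "\<dots> = c * l * t / 2"
      using G by (simp add: \<epsilon>_def divide_simps add_nonneg_eq_0_iff)
    finally have "\<bar>\<phi> (?R z) - \<phi> z'\<bar> \<le> c * l * t / 2" .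
    moreover have "\<phi> z - \<phi> (?R z) \<ge> c * l * t" using refl_l[of z] ze elim by simp
    moreover have "\<phi> z = \<phi> z'" using const F by simp
    moreover have "c * l * t > 0" using c l elim by simp
    ultimately show False by linarith
  qed
  then show False by simp
qed

section \<open>From the cap property to a disc\<close>

theorem theorem1:
  fixes D :: "(real ^ 2) set" and \<Omega> :: real
  assumes "bounded D" "open D" "connected D" "D \<noteq> {}" "simply_connected D"
    and "C1_boundary D" and "barycenter_zero D"
    and "convex D \<or> Sigma_class (arccos (1 / sqrt 5)) D"
    and "\<Omega> < 0"
    and "\<exists>\<mu>::real. \<forall>x\<in>frontier D. stream_fn D x - \<Omega> / 2 * (norm x)\<^sup>2 = \<mu>"
  shows "\<exists>c r. r > 0 \<and> D = ball c r"
proof -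
  obtain \<mu> where \<mu>: "\<And>x. x \<in> frontier D \<Longrightarrow> stream_fn D x - \<Omega> / 2 * (norm x)\<^sup>2 = \<mu>"
    using assms(10) by blast
  define \<phi> where "\<phi> x = stream_fn D x - \<Omega> / 2 * (norm x)\<^sup>2" for x
  have borel: "D \<in> sets borel" using assms(2) by simp
  obtain L where L: "\<And>x z. \<bar>stream_fn D x - stream_fn D z\<bar> \<le> L * norm (x - z)"
    using stream_fn_lipschitz[OF assms(1) borel] by blast
  have "bounded (closure D)" using assms(1) by (rule bounded_closure)
  then obtain B where B: "\<And>x. x \<in> closure D \<Longrightarrow> norm x \<le> B" by (auto simp: bounded_iff)
  \<comment> \<open>On \<open>closure D\<close> the function \<open>|x|^2\<close> has Lipschitz
    constant \<open>2 * B\<close>; the factor \<open>|\<Omega>| / 2\<close> makes this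
    \<open>- \<Omega> * B\<close>.\<close>
  have lip: "\<bar>\<phi> x - \<phi> z\<bar> \<le> (L - \<Omega> * B) * norm (x - z)" if "x \<in> closure D" "z \<in> closure D" for x z
  proof -
    have "\<bar>(norm x)\<^sup>2 - (norm z)\<^sup>2\<bar> = \<bar>norm x - norm z\<bar> * (norm x + norm z)"
      by (simp add: power2_eq_square square_diff_square_factored abs_mult mult.commute)
    also have "\<dots> \<le> norm (x - z) * (2 * B)"
      using B[OF that(1)] B[OF that(2)] norm_triangle_ineq3 by (intro mult_mono) auto
    finally have "\<bar>\<Omega>\<bar> / 2 * \<bar>(norm x)\<^sup>2 - (norm z)\<^sup>2\<bar> \<le> \<bar>\<Omega>\<bar> / 2 * (norm (x - z) * (2 * B))"
      by (rule mult_left_mono) simp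
    moreover have "\<phi> x - \<phi> z = (stream_fn D x - stream_fn D z) - \<Omega> / 2 * ((norm x)\<^sup>2 - (norm z)\<^sup>2)"
      by (simp add: \<phi>_def algebra_simps)
    then have "\<bar>\<phi> x - \<phi> z\<bar> \<le> \<bar>stream_fn D x - stream_fn D z\<bar> + \<bar>\<Omega>\<bar> / 2 * \<bar>(norm x)\<^sup>2 - (norm z)\<^sup>2\<bar>"
      by (metis abs_divide abs_mult abs_numeral abs_triangle_ineq4)
    ultimately have "\<bar>\<phi> x - \<phi> z\<bar> \<le> L * norm (x - z) + \<bar>\<Omega>\<bar> / 2 * (norm (x - z) * (2 * B))"
      using L[of x z] by linarith
    then show ?thesis using assms(9) by (simp add: algebra_simps)
  qed
  have cap: "reflection e l x \<in> D" if e: "norm e = 1" and "l > 0" "x \<in> D" "x \<bullet> e > l" for e l x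
  proof -
    have "\<forall>x\<in>D. x \<bullet> e > l \<longrightarrow> reflection e l x \<in> D"
    proof (rule moving_plane[OF assms(1,2,6) e lip _ _ _ \<open>l > 0\<close>])
      show "\<phi> x = \<mu>" if "x \<in> frontier D" for x using \<mu>[OF that] by (simp add: \<phi>_def)
      \<comment> \<open>The constant is \<open>- \<Omega> / 2\<close> times the factor 4 in
        \<open>norm_reflection\<close>.\<close>
      show "- 2 * \<Omega> > 0" using assms(9) by simp
      fix l x assume l: "l > 0" "\<forall>y\<in>D. y \<bullet> e > l \<longrightarrow> reflection e l y \<in> D" "x \<bullet> e \<ge> l"
      have "stream_fn D (reflection e l x) \<le> stream_fn D x"
        using l by (intro stream_fn_reflection_le assms borel e) auto
      then show "\<phi> x - \<phi> (reflection e l x) \<ge> - 2 * \<Omega> * l * (x \<bullet> e - l)"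
        unfolding \<phi>_def norm_reflection[OF e] by (simp add: algebra_simps)
    qed auto
    then show ?thesis using that by blast
  qed
  have radial: "y \<in> D" if x: "x \<in> D" and yx: "norm y < norm x" for x y
  proof -
    define d where "d = norm (x - y)"
    \<comment> \<open>The line with normal \<open>e\<close> and offset \<open>l\<close> is the
      perpendicular bisector of \<open>x\<close> and \<open>y\<close>; \<open>l > 0\<close> says
      that the origin is on the side of \<open>y\<close>.\<close>
    have d: "d > 0" using yx by (auto simp: d_def)
    define e where "e = (x - y) /\<^sub>R d"
    define l where "l = ((norm x)\<^sup>2 - (norm y)\<^sup>2) / (2 * d)"
    have e: "norm e = 1" using d by (simp add: e_def d_def)
    have dd: "(norm x)\<^sup>2 - (norm y)\<^sup>2 = 2 * (x \<bullet> (x - y)) - d\<^sup>2"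
      unfolding d_def power2_norm_eq_inner by (simp add: algebra_simps inner_commute)
    have xe: "x \<bullet> e = l + d / 2"
      using d unfolding l_def dd e_def inner_scaleR_right
      by (simp add: divide_simps power2_eq_square algebra_simps)
    have "l > 0" unfolding l_def using d yx by (simp add: power_strict_mono)
    moreover have "x \<bullet> e > l" using xe d by simp
    moreover have "reflection e l x = y"
      using d by (simp add: reflection_def xe) (simp add: e_def)
    ultimately show "y \<in> D" using cap[OF e _ x, of l] by simp
  qed
  define r where "r = Sup (norm ` D)"
  have bdd: "bdd_above (norm ` D)" using assms(1) by (simp add: bdd_above_norm)
  \<comment> \<open>As \<open>D\<close> is open, the supremum \<open>r\<close> is not attained, so
    the ball is open. One of \<open>x + u\<close> and \<open>x - u\<close> is longer than
    \<open>x\<close> by the parallelogram law.\<close>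
  have larger: "\<exists>y\<in>D. norm y > norm x" if x: "x \<in> D" for x
  proof -
    obtain \<rho> where \<rho>: "\<rho> > 0" "ball x \<rho> \<subseteq> D" using assms(2) x open_contains_ball by blast
    obtain u :: "real ^ 2" where u: "norm u = \<rho> / 2"
      using vector_choose_size[of "\<rho> / 2"] \<rho> by auto
    have "x + u \<in> ball x \<rho>" "x - u \<in> ball x \<rho>" using u \<rho> by (auto simp: dist_norm)
    moreover have "norm (x + u) > norm x \<or> norm (x - u) > norm x"
    proof (rule ccontr)
      assume "\<not> ?thesis"
      then have "(norm (x + u))\<^sup>2 \<le> (norm x)\<^sup>2" "(norm (x - u))\<^sup>2 \<le> (norm x)\<^sup>2"
        by (auto intro!: power_mono)
      then have "(norm u)\<^sup>2 \<le> 0"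
        unfolding power2_norm_eq_inner by (simp add: algebra_simps inner_commute)
      then show False using u \<rho> by simp
    qed
    ultimately show ?thesis using \<rho> by blast
  qed
  have "D = ball 0 r"
  proof (intro set_eqI iffI)
    fix x assume "x \<in> D"
    then obtain y where "y \<in> D" "norm y > norm x" using larger by blast
    then have "norm x < r" using cSup_upper[OF _ bdd, of "norm y"] by (force simp: r_def)
    then show "x \<in> ball 0 r" by simp
  next
    fix x :: pt assume "x \<in> ball 0 r"
    then obtain y where "y \<in> D" "norm y > norm x"
      using less_cSup_iff[OF _ bdd, of "norm x"] assms(4) by (auto simp: r_def)
    then show "x \<in> D" using radial by blast
  qed
  moreover have "r > 0" using calculation assms(4) by (metis ball_eq_empty not_less)
  ultimately show ?thesis by blast
qed

end
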